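(* Let $G,H\in\mathscr{G}$ be marked groups such that there is an injective group homomorphism $H\hookrightarrow G$. Then for all integers $l\geq k\geq 1$, $$\rho\left(T^l(H)\right)\leq\rho\left(T^k(G)\right).$$ In particular, for $G,G'\in\mathscr{G}$, if $G\cong G'$ (as groups), then $\rho(T^l(G))=\rho(T^l(G'))$ for all $l\geq 1$.
   Context: Marked groups. Let $\mathbb{F}_\omega$ be the free group on letters $(a_i)_{i\in\mathbb{N}}$, with a fixed enumeration $(\gamma_i)_{i\in\mathbb{N}}$ of its elements. A marked group is $G=\mathbb{F}_\omega/N$ with $N\trianglelefteq\mathbb{F}_\omega$; with $f_N:\mathbb{F}_\omega\to G$ the projection, $G$ is given the enumeration $g_i:=f_N(\gamma_i)$, $i\in\mathbb{N}$ (repetitions allowed). $\mathscr{G}$ denotes the set of all marked groups. A subgroup $H\le G$ is regarded as the marked group $\mathbb{F}_\omega/\ker(f_N\circ\pi_H)$, where $\pi_H:\mathbb{F}_\omega\to\mathbb{F}_\omega$ is the homomorphism with $\pi_H(a_j)=\gamma_j$ if $f_N(\gamma_j)\in H$ and $\pi_H(a_j)=e$ otherwise; but if $H$ is given with a distinguished finite generating set $\{g_{i_0},\dots,g_{i_n}\}$, one instead puts $\pi_H(a_{i_j})=\gamma_{i_j}$ for $0\le j\le n$ and $\pi_H(a_i)=e$ for all other $i$. Trees. A tree is a set $T\subseteq\mathbb{N}^{<\mathbb{N}}$ of finite sequences of natural numbers closed under initial segments; it is well-founded if there is no $x\in\mathbb{N}^{\mathbb{N}}$ all of whose finite initial segments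 lie in $T$. $|s|$ is the length of $s$ and $(s,n)$ is the sequence $s$ extended by the term $n$. For a nonempty well-founded tree $T$, define $\rho_T(t)=\sup\{\rho_T(s)+1\mid s\in T,\ t\subsetneq s\}$ (so $\rho_T(t)=0$ if $t$ has no proper extension in $T$) and $\rho(T)=\rho_T(\emptyset)+1$; put $\rho(\emptyset)=0$, and $\rho(T)=\omega_1$ if $T$ is not well-founded. Decomposition trees. For a marked group $G$ and $n\ge0$ let $R_n(G):=\langle g_0,\dots,g_n\rangle$ (marked using this generating set), and for $k\ge1$ let $S_k(G):=[G,G]\cap\bigcap\{M\trianglelefteq G\mid |G:M|\le k+1\}$. For $l\ge1$ the tree $T^l(G)$ and marked groups $G_s$ for $s\in T^l(G)$ are defined recursively: $\emptyset\in T^l(G)$ and $G_\emptyset:=G$; if $s\in T^l(G)$ and $G_s\ne\{e\}$, then for every $n\in\mathbb{N}$ put $(s,n)\in T^l(G)$ and $G_{(s,n)}:=S_{|s|+l}(R_n(G_s))$; if $G_s=\{e\}$, then $s$ has no extensions in $T^l(G)$. *)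

theory Defs
  imports "HOL-Algebra.Generated_Groups" "HOL-Library.Sublist"
begin

section \<open>Ordinals\<close>

text \<open>
  Order types of well-orders on sets of sets of naturals. These include all countable ordinals
  and \<open>\<omega>\<^sub>1\<close>, which is everything needed for ranks of trees on the natural numbers.
  (The relation \<^const>\<open>ordIso\<close> relates only well-orders.)
\<close>

quotient_type ordinal = "nat set rel" / partial: "\<lambda>r s. (r, s) \<in> ordIso"
proof (rule part_equivpI)
  show "\<exists>x :: nat set rel. (x, x) \<in> ordIso"
    using ordIso_reflexive[OF card_of_Well_order] by blast
  show "symp (\<lambda>r s :: nat set rel. (r, s) \<in> ordIso)"
    by (auto intro: sympI ordIso_symmetric)
  show "transp (\<lambda>r s :: nat set rel. (r, s) \<in> ordIso)"
    by (auto intro: transpI ordIso_transitive)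
qed

lemma ordIso_imp_Well_order: "(r, s) \<in> ordIso \<Longrightarrow> Well_order r \<and> Well_order s"
  by (auto simp: ordIso_def)

lemma ordIso_self_iff: "(r, r) \<in> ordIso \<longleftrightarrow> Well_order r"
  using ordIso_imp_Well_order ordIso_reflexive by blast

instantiation ordinal :: linorder
begin

lift_definition less_eq_ordinal :: "ordinal \<Rightarrow> ordinal \<Rightarrow> bool" is "\<lambda>r s. (r, s) \<in> ordLeq"
  by (meson ordIso_ordLeq_trans ordIso_symmetric ordLeq_ordIso_trans)

lift_definition less_ordinal :: "ordinal \<Rightarrow> ordinal \<Rightarrow> bool" is "\<lambda>r s. (r, s) \<in> ordLess"
  by (meson ordIso_ordLess_trans ordIso_symmetric ordLess_ordIso_trans)

instance
proof
  fix x y z :: ordinal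
  show "(x < y) = (x \<le> y \<and> \<not> y \<le> x)"
    by transfer (metis ordIso_imp_Well_order not_ordLeq_iff_ordLess ordLess_imp_ordLeq)
  show "x \<le> x"
    by transfer (auto dest!: ordIso_imp_Well_order intro: ordLeq_reflexive)
  show "x \<le> y \<Longrightarrow> y \<le> z \<Longrightarrow> x \<le> z"
    by transfer (rule ordLeq_transitive)
  show "x \<le> y \<Longrightarrow> y \<le> x \<Longrightarrow> x = y"
    by transfer (simp add: ordIso_iff_ordLeq)
  show "x \<le> y \<or> y \<le> x"
    by transfer (metis ordIso_imp_Well_order ordLeq_total)
qed

end

lemma wf_less_ordinal: "wf {(x, y :: ordinal). x < y}"
proof -
  have "wf (inv_image (ordLess :: (nat set rel \<times> nat set rel) set) rep_ordinal)"
    by (rule wf_inv_image[OF wf_ordLess])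
  moreover have "{(x, y :: ordinal). x < y} \<subseteq> inv_image ordLess rep_ordinal"
    by (auto simp: less_ordinal.rep_eq)
  ultimately show ?thesis by (rule wf_subset)
qed

instance ordinal :: wellorder
  using wf_less_ordinal by intro_classes (auto elim: wf_induct_rule)

instantiation ordinal :: zero
begin

lift_definition zero_ordinal :: ordinal is "{} :: nat set rel"
  by (simp add: ordIso_self_iff)

instance ..

end

lemma zero_le_ordinal: "(0 :: ordinal) \<le> x"
  by transfer (auto dest!: ordIso_imp_Well_order
      simp: ordLeq_def embed_def bij_betw_def under_def Field_def)

instantiation ordinal :: conditionally_complete_linorder
begin

definition inf_ordinal :: "ordinal \<Rightarrow> ordinal \<Rightarrow> ordinal" where "inf_ordinal = min"
definition sup_ordinal :: "ordinal \<Rightarrow> ordinal \<Rightarrow> ordinal" where "sup_ordinal = max"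
definition Inf_ordinal :: "ordinal set \<Rightarrow> ordinal" where "Inf_ordinal X = (LEAST x. x \<in> X)"
definition Sup_ordinal :: "ordinal set \<Rightarrow> ordinal" where "Sup_ordinal X = (LEAST z. \<forall>x\<in>X. x \<le> z)"

instance
proof
  fix x y z :: ordinal and X :: "ordinal set"
  show "inf_class.inf x y \<le> x" "inf_class.inf x y \<le> y" "x \<le> sup_class.sup x y" "y \<le> sup_class.sup x y"
    by (auto simp: inf_ordinal_def sup_ordinal_def)
  show "x \<le> y \<Longrightarrow> x \<le> z \<Longrightarrow> x \<le> inf_class.inf y z" "y \<le> x \<Longrightarrow> z \<le> x \<Longrightarrow> sup_class.sup y z \<le> x"
    by (auto simp: inf_ordinal_def sup_ordinal_def)
  show "x \<in> X \<Longrightarrow> Inf X \<le> x" by (simp add: Inf_ordinal_def Least_le)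
  show "X \<noteq> {} \<Longrightarrow> (\<And>x. x \<in> X \<Longrightarrow> z \<le> x) \<Longrightarrow> z \<le> Inf X"
    unfolding Inf_ordinal_def by (metis LeastI_ex all_not_in_conv)
  show "x \<le> Sup X" if "x \<in> X" "bdd_above X"
  proof -
    from \<open>bdd_above X\<close> obtain b where "\<forall>x\<in>X. x \<le> b" by (auto simp: bdd_above_def)
    hence "\<forall>x\<in>X. x \<le> (LEAST z. \<forall>x\<in>X. x \<le> z)" by (rule LeastI)
    with \<open>x \<in> X\<close> show ?thesis by (simp add: Sup_ordinal_def)
  qed
  show "X \<noteq> {} \<Longrightarrow> (\<And>x. x \<in> X \<Longrightarrow> x \<le> z) \<Longrightarrow> Sup X \<le> z"
    unfolding Sup_ordinal_def by (auto intro: Least_le)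
qed

end

lemma Sup_empty_ordinal: "Sup {} = (0 :: ordinal)"
  unfolding Sup_ordinal_def by (rule Least_equality) (auto simp: zero_le_ordinal)

text \<open>
  Only used up to \<open>\<omega>\<^sub>1\<close>, where the required upper bounds exist and these are the usual
  supremum and successor of ordinals.
\<close>

definition osucc :: "ordinal \<Rightarrow> ordinal" where
  "osucc \<alpha> = (LEAST \<beta>. \<alpha> < \<beta>)"

lift_definition omega1 :: ordinal is "cardSuc natLeq"
  using cardSuc_Card_order[OF natLeq_Card_order] card_order_on_well_order_on
  by (auto simp: ordIso_self_iff)

lemma osucc_countable:
  assumes "\<alpha> < omega1"
  shows "\<alpha> < osucc \<alpha>" and "osucc \<alpha> \<le> omega1"
  unfolding osucc_def using assms by (rule LeastI, rule Least_le)


section \<open>Trees\<close>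

definition is_tree :: "nat list set \<Rightarrow> bool" where
  "is_tree T \<longleftrightarrow> (\<forall>t\<in>T. \<forall>s. prefix s t \<longrightarrow> s \<in> T)"

definition wf_tree :: "nat list set \<Rightarrow> bool" where
  "wf_tree T \<longleftrightarrow> \<not> (\<exists>x :: nat \<Rightarrow> nat. \<forall>n. map x [0..<n] \<in> T)"

text \<open>The recursion below is along a well-founded relation exactly when \<open>T\<close> is well-founded.\<close>

definition node_rank :: "nat list set \<Rightarrow> nat list \<Rightarrow> ordinal" where
  "node_rank T = wfrec {(s, t). s \<in> T \<and> strict_prefix t s}
     (\<lambda>\<rho> t. SUP s \<in> {s \<in> T. strict_prefix t s}. osucc (\<rho> s))"

definition tree_rank :: "nat list set \<Rightarrow> ordinal" where
  "tree_rank T =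
     (if T = {} then 0 else if wf_tree T then osucc (node_rank T []) else omega1)"

lemma wf_tree_rel:
  assumes "is_tree T" "wf_tree T"
  shows "wf {(s, t). s \<in> T \<and> strict_prefix t s}"
proof (rule ccontr)
  assume "\<not> ?thesis"
  then obtain f where "\<And>i. (f (Suc i), f i) \<in> {(s, t). s \<in> T \<and> strict_prefix t s}"
    by (auto simp: wf_iff_no_infinite_down_chain)
  hence f: "f (Suc i) \<in> T" "strict_prefix (f i) (f (Suc i))" for i by auto
  have mono: "prefix (f i) (f j)" if "i \<le> j" for i j
    using that by (induction rule: dec_induct)
      (auto intro: prefix_order.trans strict_prefixE f(2)[THEN prefix_order.less_imp_le])
  have len: "i \<le> length (f i)" for i
    by (induction i) (auto intro: Suc_leI le_less_trans prefix_length_less f(2))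
  define x where "x n = f (Suc n) ! n" for n
  have "map x [0..<n] \<in> T" for n
  proof -
    have "map x [0..<n] = take n (f (Suc n))"
    proof (rule nth_equalityI)
      show "length (map x [0..<n]) = length (take n (f (Suc n)))"
        using len[of "Suc n"] by simp
      fix i assume "i < length (map x [0..<n])"
      hence i: "i < n" by simp
      obtain zs where zs: "f (Suc n) = f (Suc i) @ zs"
        using mono[of "Suc i" "Suc n"] i by (auto elim: prefixE)
      show "map x [0..<n] ! i = take n (f (Suc n)) ! i"
        using i len[of "Suc i"] by (simp add: zs x_def nth_append)
    qed
    moreover have "take n (f (Suc n)) \<in> T"
      using assms(1) f(1)[of n] take_is_prefix unfolding is_tree_def by blast
    ultimately show ?thesis by simp
  qed
  with assms(2) show False by (auto simp: wf_tree_def)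
qed

lemma node_rank_eq:
  assumes "is_tree T" "wf_tree T"
  shows "node_rank T t = (SUP s \<in> {s \<in> T. strict_prefix t s}. osucc (node_rank T s))"
proof -
  have "node_rank T t = (SUP s \<in> {s \<in> T. strict_prefix t s}.
      osucc (cut (node_rank T) {(s, t). s \<in> T \<and> strict_prefix t s} t s))"
    by (subst (1) node_rank_def, subst wfrec[OF wf_tree_rel[OF assms]])
      (simp add: node_rank_def)
  also have "\<dots> = (SUP s \<in> {s \<in> T. strict_prefix t s}. osucc (node_rank T s))"
    by (intro arg_cong[where f = Sup] image_cong) (auto simp: cut_apply)
  finally show ?thesis .
qed


section \<open>The free group on countably many letters\<close>

text \<open>
  The pair \<open>(False, i)\<close> stands for the letter \<open>a\<^sub>i\<close> and \<open>(True, i)\<close> for its inverse. The group is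
  realised on the reduced words.
\<close>

type_synonym word = "(bool \<times> nat) list"

definition inv_letter :: "bool \<times> nat \<Rightarrow> bool \<times> nat" where
  "inv_letter x = (\<not> fst x, snd x)"

fun reduced :: "word \<Rightarrow> bool" where
  "reduced [] \<longleftrightarrow> True"
| "reduced [x] \<longleftrightarrow> True"
| "reduced (x # y # w) \<longleftrightarrow> y \<noteq> inv_letter x \<and> reduced (y # w)"

fun rcons :: "bool \<times> nat \<Rightarrow> word \<Rightarrow> word" where
  "rcons x [] = [x]"
| "rcons x (y # w) = (if y = inv_letter x then w else x # y # w)"

definition free_group :: "word monoid" (\<open>\<F>\<close>) where
  "\<F> = \<lparr>carrier = {w. reduced w}, monoid.mult = (\<lambda>u v. foldr rcons u v), one = []\<rparr>"

definition letter :: "nat \<Rightarrow> word" where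
  "letter i = [(False, i)]"

text \<open>The homomorphism \<open>\<F> \<rightarrow> G\<close> sending each letter \<open>a\<^sub>i\<close> to \<open>f i\<close>.\<close>

definition free_hom :: "('a, 'b) monoid_scheme \<Rightarrow> (nat \<Rightarrow> 'a) \<Rightarrow> word \<Rightarrow> 'a" where
  "free_hom G f w =
     foldr (\<lambda>(b, i) z. (if b then inv\<^bsub>G\<^esub> f i else f i) \<otimes>\<^bsub>G\<^esub> z) w \<one>\<^bsub>G\<^esub>"

lemma inv_letter_inv_letter [simp]: "inv_letter (inv_letter x) = x"
  by (simp add: inv_letter_def)

lemma inv_letter_neq [simp]: "inv_letter x \<noteq> x"
  by (cases x) (simp add: inv_letter_def)

lemma reduced_ConsD: "reduced (x # w) \<Longrightarrow> reduced w"
  by (cases w) auto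

lemma reduced_rcons: "reduced w \<Longrightarrow> reduced (rcons x w)"
  by (cases w) (auto dest: reduced_ConsD)

lemma reduced_foldr_rcons: "reduced w \<Longrightarrow> reduced (foldr rcons u w)"
  by (induction u) (auto intro: reduced_rcons)

lemma rcons_inv: "reduced w \<Longrightarrow> rcons (inv_letter x) (rcons x w) = w"
  by (cases w; cases "tl w") auto

lemma rcons_inv': "reduced w \<Longrightarrow> rcons x (rcons (inv_letter x) w) = w"
  using rcons_inv[of w "inv_letter x"] by simp

lemma foldr_rcons_rcons:
  "reduced w \<Longrightarrow> foldr rcons (rcons x u) w = rcons x (foldr rcons u w)"
  by (cases u) (auto simp: rcons_inv' reduced_foldr_rcons)

lemma foldr_rcons_assoc:
  "reduced w \<Longrightarrow> foldr rcons (foldr rcons u v) w = foldr rcons u (foldr rcons v w)"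
  by (induction u) (auto simp: foldr_rcons_rcons)

lemma foldr_rcons_Nil: "reduced u \<Longrightarrow> foldr rcons u [] = u"
proof (induction u)
  case (Cons x u)
  thus ?case by (cases u) (auto dest: reduced_ConsD)
qed simp

lemma foldr_rcons_inverse:
  "reduced w \<Longrightarrow> foldr rcons (map inv_letter (rev u)) (foldr rcons u w) = w"
  by (induction u arbitrary: w) (auto simp: rcons_inv reduced_foldr_rcons)

lemma group_free_group: "group \<F>"
proof (rule groupI)
  fix x y z assume "x \<in> carrier \<F>" "y \<in> carrier \<F>" "z \<in> carrier \<F>"
  thus "x \<otimes>\<^bsub>\<F>\<^esub> y \<otimes>\<^bsub>\<F>\<^esub> z = x \<otimes>\<^bsub>\<F>\<^esub> (y \<otimes>\<^bsub>\<F>\<^esub> z)"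
    by (simp add: free_group_def foldr_rcons_assoc)
next
  fix x assume x: "x \<in> carrier \<F>"
  have "foldr rcons (foldr rcons (map inv_letter (rev x)) []) x = []"
    using x foldr_rcons_inverse[of "[]" x]
    by (simp add: free_group_def foldr_rcons_assoc foldr_rcons_Nil)
  moreover have "reduced (foldr rcons (map inv_letter (rev x)) [])"
    by (rule reduced_foldr_rcons) simp
  ultimately show "\<exists>y\<in>carrier \<F>. y \<otimes>\<^bsub>\<F>\<^esub> x = \<one>\<^bsub>\<F>\<^esub>"
    by (auto simp: free_group_def)
qed (auto simp: free_group_def reduced_foldr_rcons)

lemma free_hom_hom:
  assumes "group G" and f: "\<And>i. f i \<in> carrier G"
  shows "free_hom G f \<in> hom \<F> G" and "free_hom G f (letter i) = f i"
proof -
  interpret group G by fact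
  have Cons: "free_hom G f (x # w) =
      (if fst x then inv\<^bsub>G\<^esub> f (snd x) else f (snd x)) \<otimes>\<^bsub>G\<^esub> free_hom G f w" for x w
    by (cases x) (simp add: free_hom_def)
  have Nil: "free_hom G f [] = \<one>\<^bsub>G\<^esub>" by (simp add: free_hom_def)
  have closed: "free_hom G f w \<in> carrier G" for w
    by (induction w) (auto simp: Cons Nil f)
  have rcons: "free_hom G f (rcons x w) = free_hom G f (x # w)" for x w
  proof (cases w)
    case (Cons y v)
    thus ?thesis
      by (auto simp: \<open>\<And>x w. free_hom G f (x # w) = _\<close> inv_letter_def closed f
          m_assoc[symmetric])
  qed simp
  have "free_hom G f (foldr rcons u v) = free_hom G f u \<otimes>\<^bsub>G\<^esub> free_hom G f v" for u v
    by (induction u) (auto simp: rcons Cons Nil closed f m_assoc)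
  with closed show "free_hom G f \<in> hom \<F> G" by (auto simp: hom_def free_group_def)
  show "free_hom G f (letter i) = f i" by (simp add: letter_def Cons Nil f)
qed


section \<open>Marked groups\<close>

text \<open>
  A marked group \<open>\<F> / N\<close> is represented by the normal subgroup \<open>N\<close>. Throughout, \<open>\<gamma>\<close> is the chosen
  enumeration of \<open>\<F>\<close>.
\<close>

definition marked_groups :: "word set set" where
  "marked_groups = {N. N \<lhd> \<F>}"

abbreviation grp :: "word set \<Rightarrow> word set monoid" where
  "grp N \<equiv> \<F> Mod N"

definition proj :: "word set \<Rightarrow> word \<Rightarrow> word set" where
  "proj N w = N #>\<^bsub>\<F>\<^esub> w"

text \<open>
  The kernel of \<open>f\<^sub>N \<circ> \<pi>\<close>, where \<open>f\<^sub>N\<close> is the projection and \<open>\<pi>\<close> is the endomorphism of \<open>\<F>\<close> with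
  \<open>\<pi>(a\<^sub>j) = p j\<close>. The quotient by it is isomorphic to the subgroup of \<open>\<F> / N\<close> that is the range of
  \<open>f\<^sub>N \<circ> \<pi>\<close>.
\<close>

definition mark_via :: "word set \<Rightarrow> (nat \<Rightarrow> word) \<Rightarrow> word set" where
  "mark_via N p = kernel \<F> (grp N) (proj N \<circ> free_hom \<F> p)"

definition mark_subgroup :: "(nat \<Rightarrow> word) \<Rightarrow> word set \<Rightarrow> word set set \<Rightarrow> word set" where
  "mark_subgroup \<gamma> N H = mark_via N (\<lambda>j. if proj N (\<gamma> j) \<in> H then \<gamma> j else \<one>\<^bsub>\<F>\<^esub>)"

text \<open>The subgroup generated by the \<open>g\<^sub>i\<close> with \<open>i \<in> I\<close>, marked by these generators.\<close>

definition mark_generated :: "(nat \<Rightarrow> word) \<Rightarrow> word set \<Rightarrow> nat set \<Rightarrow> word set" where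
  "mark_generated \<gamma> N I = mark_via N (\<lambda>i. if i \<in> I then \<gamma> i else \<one>\<^bsub>\<F>\<^esub>)"

lemma mark_via_in_marked_groups:
  assumes "N \<in> marked_groups" and "\<And>j. p j \<in> carrier \<F>"
  shows "mark_via N p \<in> marked_groups"
proof -
  interpret normal N \<F> using assms(1) by (simp add: marked_groups_def)
  have "proj N = (\<lambda>w. N #>\<^bsub>\<F>\<^esub> w)" by (auto simp: proj_def)
  hence "proj N \<in> hom \<F> (grp N)" using r_coset_hom_Mod by simp
  with free_hom_hom(1)[of \<F> p, OF group_free_group assms(2)]
  have "proj N \<circ> free_hom \<F> p \<in> hom \<F> (grp N)"
    by (rule Group.hom_compose)
  hence "group_hom \<F> (grp N) (proj N \<circ> free_hom \<F> p)"
    using factorgroup_is_group by (simp add: group_hom_def group_hom_axioms_def group_free_group)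
  thus ?thesis
    by (simp add: mark_via_def marked_groups_def group_hom.normal_kernel)
qed


section \<open>Decomposition trees\<close>

definition R_marked :: "(nat \<Rightarrow> word) \<Rightarrow> nat \<Rightarrow> word set \<Rightarrow> word set" where
  "R_marked \<gamma> n N = mark_generated \<gamma> N {0..n}"

text \<open>Finiteness is explicit because \<^const>\<open>card\<close> is \<open>0\<close> on infinite sets.\<close>

definition S_subgroup :: "nat \<Rightarrow> ('a, 'b) monoid_scheme \<Rightarrow> 'a set" where
  "S_subgroup k G = derived G (carrier G) \<inter>
     \<Inter>{M. M \<lhd> G \<and> finite (rcosets\<^bsub>G\<^esub> M) \<and> card (rcosets\<^bsub>G\<^esub> M) \<le> k + 1}"

definition S_marked :: "(nat \<Rightarrow> word) \<Rightarrow> nat \<Rightarrow> word set \<Rightarrow> word set" where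
  "S_marked \<gamma> k N = mark_subgroup \<gamma> N (S_subgroup k (grp N))"

text \<open>\<open>decomp \<gamma> l N s M\<close> says that \<open>s \<in> T\<^sup>l(G)\<close> and \<open>G\<^sub>s = \<F> / M\<close>, where \<open>G = \<F> / N\<close>.\<close>

inductive decomp :: "(nat \<Rightarrow> word) \<Rightarrow> nat \<Rightarrow> word set \<Rightarrow> nat list \<Rightarrow> word set \<Rightarrow> bool"
  for \<gamma> l N where
  root: "decomp \<gamma> l N [] N"
| step: "decomp \<gamma> l N s M \<Longrightarrow> carrier (grp M) \<noteq> {\<one>\<^bsub>grp M\<^esub>} \<Longrightarrow>
    decomp \<gamma> l N (s @ [n]) (S_marked \<gamma> (length s + l) (R_marked \<gamma> n M))"

definition decomp_tree :: "(nat \<Rightarrow> word) \<Rightarrow> nat \<Rightarrow> word set \<Rightarrow> nat list set" where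
  "decomp_tree \<gamma> l N = {s. \<exists>M. decomp \<gamma> l N s M}"

lemma is_tree_decomp_tree: "is_tree (decomp_tree \<gamma> l N)"
proof -
  have "\<forall>t. prefix t s \<longrightarrow> t \<in> decomp_tree \<gamma> l N" if "decomp \<gamma> l N s M" for s M
    using that
  proof induction
    case root
    thus ?case by (auto simp: decomp_tree_def intro: decomp.root)
  next
    case (step s M n)
    hence "decomp \<gamma> l N (s @ [n]) (S_marked \<gamma> (length s + l) (R_marked \<gamma> n M))" by (intro decomp.step)
    with step show ?case by (auto simp: decomp_tree_def)
  qed
  thus ?thesis by (auto simp: is_tree_def decomp_tree_def)
qed

lemma decomp_unique: "decomp \<gamma> l N s M \<Longrightarrow> decomp \<gamma> l N s M' \<Longrightarrow> M = M'"
proof (induction arbitrary: M' rule: decomp.induct)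
  case root
  thus ?case by (auto elim: decomp.cases)
next
  case (step s M n)
  from step.prems show ?case by cases (auto dest: step.IH)
qed

end

theory Submission
  imports Defs "HOL-Library.Countable_Set_Type"
begin

text \<open>
  An embedding \<open>H \<hookrightarrow> G\<close> induces a level-preserving simulation of the tree of \<open>H\<close> by the tree
  of \<open>G\<close>: a node \<open>s\<close> of the first is matched with nodes \<open>t\<close> of the second of the same
  length such that \<open>H\<^sub>s\<close> embeds into \<open>G\<^sub>t\<close>. The root is matched with the root. If
  \<open>H\<^sub>s\<close> embeds into \<open>G\<^sub>t\<close> and \<open>s\<close> has a child, then \<open>H\<^sub>s\<close> and hence \<open>G\<^sub>t\<close> is
  nontrivial, so \<open>t\<close> has children too. The images of the first \<open>n + 1\<close> elements of \<open>H\<^sub>s\<close>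
  all occur among the first \<open>m + 1\<close> elements of \<open>G\<^sub>t\<close> for some \<open>m\<close>, so the embedding carries
  \<open>R\<^sub>n(H\<^sub>s)\<close> into \<open>R\<^sub>m(G\<^sub>t)\<close> (\<open>R_marked_mon\<close>). Finally \<open>S\<^sub>k\<close> grows with the group and
  shrinks when \<open>k\<close> grows (\<open>S_subgroup_mon_image\<close>): commutators go to commutators, and a normal
  subgroup of small index in the larger group pulls back to a normal subgroup of at most the same
  index. Hence \<open>H\<^bsub>(s,n)\<^esub>\<close> embeds into \<open>G\<^bsub>(t,m)\<^esub>\<close>, for \<open>l \<ge> k\<close>.

  Only embeddings matter here, never the particular markings: a marked subgroup is, up to
  isomorphism, the subgroup generated by its marked generators (\<open>mark_via_iso\<close>), so a map
  between ambient groups that respects the generated subgroups yields an embedding of the marked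
  groups (\<open>mark_via_mon\<close>).

  A simulation carries an infinite branch to an infinite branch, and by induction it does not
  decrease ranks of nodes (\<open>tree_rank_simulation\<close>). What remains is the case where only the
  tree of \<open>G\<close> is ill-founded. There one needs that a well-founded tree on the natural numbers has
  rank at most \<open>\<omega>\<^sub>1\<close>, which follows from the regularity of \<open>\<omega>\<^sub>1\<close>. Regularity also ensures
  that the suprema and successors defining the ranks are the true ones.
  An isomorphism gives embeddings in both directions, so the second claim follows from the first.
\<close>

section \<open>Countable ordinals\<close>

text \<open>
  This is the regularity of \<open>\<omega>\<^sub>1\<close>. An ordinal below \<open>\<omega>\<^sub>1\<close> is an initial segment
  \<open>underS r a\<close> of the well-order \<open>r\<close> representing \<open>\<omega>\<^sub>1\<close>, so a countable set of such ordinals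
  becomes a countable set of points of the successor cardinal \<open>r\<close>, which is bounded.
\<close>

lemma countable_ordinals_bounded:
  assumes "countable X" and below: "\<And>\<alpha>. \<alpha> \<in> X \<Longrightarrow> \<alpha> < omega1"
  shows "\<exists>\<beta><omega1. \<forall>\<alpha>\<in>X. \<alpha> < \<beta>"
proof -
  let ?r = "cardSuc natLeq :: nat set rel"
  have card: "Card_order ?r" and inf: "\<not> finite (Field ?r)"
    using cardSuc_Card_order[OF natLeq_Card_order] cardSuc_finite[OF natLeq_Card_order]
    by (simp_all add: Field_natLeq)
  have W: "Well_order ?r" using card by (simp add: card_order_on_well_order_on)
  hence tr: "trans ?r" and as: "antisym ?r"
    by (simp_all add: order_on_defs)
  have of: "wo_rel.ofilter ?r (underS ?r a)" for a
    using W by (simp add: wo_rel_def wo_rel.underS_ofilter)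
  have omega1: "omega1 = abs_ordinal ?r" by (simp add: omega1_def)
  have "\<exists>a\<in>Field ?r. \<alpha> = abs_ordinal (Restr ?r (underS ?r a))" if "\<alpha> \<in> X" for \<alpha>
  proof -
    have "(rep_ordinal \<alpha>, rep_ordinal omega1) \<in> ordLess"
      using below[OF that] by (simp add: less_ordinal.rep_eq)
    moreover have "(rep_ordinal omega1, ?r) \<in> ordIso"
      unfolding omega1 using Quotient3_rep_abs[OF Quotient3_ordinal, of ?r] W
      by (simp add: ordIso_self_iff)
    ultimately have "(rep_ordinal \<alpha>, ?r) \<in> ordLess" by (rule ordLess_ordIso_trans)
    then obtain a where "a \<in> Field ?r" "(rep_ordinal \<alpha>, Restr ?r (underS ?r a)) \<in> ordIso"
      using ordLess_iff_ordIso_Restr[OF W] by (auto simp: ordLess_def)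
    thus ?thesis
      by (metis Quotient3_abs_rep[OF Quotient3_ordinal] Quotient3_rel_abs[OF Quotient3_ordinal])
  qed
  then obtain f where f: "\<And>\<alpha>. \<alpha> \<in> X \<Longrightarrow> f \<alpha> \<in> Field ?r"
    "\<And>\<alpha>. \<alpha> \<in> X \<Longrightarrow> \<alpha> = abs_ordinal (Restr ?r (underS ?r (f \<alpha>)))"
    by metis
  \<comment> \<open>The initial segments form a chain covering every point, as \<open>r\<close> has no last point. So
    a countable set of points is already contained in one of them.\<close>
  have "\<exists>b\<in>Field ?r. f ` X \<subseteq> underS ?r b"
  proof (rule cardSuc_UNION[OF natLeq_Card_order])
    show "\<not> finite (Field natLeq)" by (simp add: Field_natLeq)
    show "relChain ?r (underS ?r)"
      using underS_incr[OF tr as] by (auto simp: relChain_def)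
    show "f ` X \<subseteq> (\<Union>b\<in>Field ?r. underS ?r b)"
    proof
      fix a assume "a \<in> f ` X"
      then obtain b where "b \<in> Field ?r" "a \<noteq> b" "(a, b) \<in> ?r"
        using infinite_Card_order_limit[OF card inf] f(1) by blast
      thus "a \<in> (\<Union>b\<in>Field ?r. underS ?r b)" by (auto simp: underS_def)
    qed
    show "(card_of (f ` X), natLeq) \<in> ordLeq"
      using assms(1) by (simp flip: countable_card_le_natLeq)
  qed
  then obtain b where b: "b \<in> Field ?r" "f ` X \<subseteq> underS ?r b" by blast
  let ?\<beta> = "abs_ordinal (Restr ?r (underS ?r b))"
  have WR: "Well_order (Restr ?r A)" for A by (rule Well_order_Restr[OF W])
  have "?\<beta> < omega1"
    unfolding omega1 using underS_Restr_ordLess[OF W] b W WR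
    by (subst less_ordinal.abs_eq) (auto simp: ordIso_self_iff)
  moreover have "\<alpha> < ?\<beta>" if "\<alpha> \<in> X" for \<alpha>
  proof -
    have "f \<alpha> \<in> underS ?r b" using b that by blast
    hence "underS ?r (f \<alpha>) \<subset> underS ?r b"
      using underS_incr[OF tr as, of "f \<alpha>" b] underS_notIn[of "f \<alpha>" ?r]
      by (auto simp: underS_def)
    hence "(Restr ?r (underS ?r (f \<alpha>)), Restr ?r (underS ?r b)) \<in> ordLess"
      using ofilter_subset_ordLess[OF W of of] by blast
    thus ?thesis using WR
      by (subst f(2)[OF that], subst less_ordinal.abs_eq) (auto simp: ordIso_self_iff)
  qed
  ultimately show ?thesis by blast
qed

lemma osucc_le_iff:
  assumes "\<alpha> < omega1"
  shows "osucc \<alpha> \<le> \<beta> \<longleftrightarrow> \<alpha> < \<beta>"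
proof
  show "\<alpha> < \<beta>" if "osucc \<alpha> \<le> \<beta>"
    using osucc_countable(1)[OF assms] that by (rule less_le_trans)
  show "osucc \<alpha> \<le> \<beta>" if "\<alpha> < \<beta>"
    unfolding osucc_def using that by (rule Least_le)
qed

lemma SUP_ordinal_least: "(\<And>x. x \<in> A \<Longrightarrow> f x \<le> (\<beta> :: ordinal)) \<Longrightarrow> (SUP x\<in>A. f x) \<le> \<beta>"
  unfolding Sup_ordinal_def by (auto intro!: Least_le)

text \<open>
  A node has only countably many extensions, so by induction their ranks have a common strict upper
  bound below \<open>\<omega>\<^sub>1\<close>.
\<close>

lemma node_rank_less_omega1:
  assumes "is_tree T" "wf_tree T"
  shows "node_rank T t < omega1"
  using wf_tree_rel[OF assms]
proof (induction t rule: wf_induct_rule)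
  case (less t)
  let ?S = "{s \<in> T. strict_prefix t s}"
  have IH: "node_rank T s < omega1" if "s \<in> ?S" for s using less that by auto
  have "\<exists>\<beta><omega1. \<forall>\<alpha>\<in>node_rank T ` ?S. \<alpha> < \<beta>"
    using IH by (intro countable_ordinals_bounded) auto
  then obtain \<beta> where \<beta>: "\<beta> < omega1" "\<And>s. s \<in> ?S \<Longrightarrow> node_rank T s < \<beta>" by blast
  have "node_rank T t \<le> \<beta>"
    using \<beta>(2) IH by (subst node_rank_eq[OF assms]) (auto intro!: SUP_ordinal_least simp: osucc_le_iff)
  with \<beta>(1) show ?case by simp
qed

text \<open>
  The supremum of a set of ordinals is only meaningful for bounded sets; the bound is \<open>\<omega>\<^sub>1\<close>.
\<close>

lemma node_rank_extension_less:
  assumes "is_tree T" "wf_tree T" "s \<in> T" "strict_prefix t s"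
  shows "node_rank T s < node_rank T t"
proof -
  let ?S = "{s \<in> T. strict_prefix t s}"
  have "bdd_above ((\<lambda>s. osucc (node_rank T s)) ` ?S)"
    using osucc_countable(2) node_rank_less_omega1[OF assms(1,2)] by (auto intro!: bdd_aboveI2)
  hence "osucc (node_rank T s) \<le> node_rank T t"
    using assms(3,4) by (subst (2) node_rank_eq[OF assms(1,2)]) (auto intro!: cSUP_upper)
  thus ?thesis by (simp add: osucc_le_iff node_rank_less_omega1[OF assms(1,2)])
qed

lemma tree_rank_le_omega1:
  assumes "is_tree T"
  shows "tree_rank T \<le> omega1"
  using osucc_countable(2)[OF node_rank_less_omega1[OF assms]]
  by (simp add: tree_rank_def zero_le_ordinal)


section \<open>Simulations of trees\<close>

text \<open>
  Following an infinite branch of \<open>T\<close> with the simulation, one child at a time, gives an infinite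
  branch of \<open>T'\<close>.
\<close>

lemma wf_tree_simulation:
  assumes root: "P [] []"
    and step: "\<And>s t n. P s t \<Longrightarrow> s @ [n] \<in> T \<Longrightarrow> \<exists>m. t @ [m] \<in> T' \<and> P (s @ [n]) (t @ [m])"
    and T': "[] \<in> T'" "wf_tree T'"
  shows "wf_tree T"
  unfolding wf_tree_def
proof
  assume "\<exists>x. \<forall>n. map x [0..<n] \<in> T"
  then obtain x where x: "\<And>n. map x [0..<n] \<in> T" by blast
  have "\<exists>g. \<forall>n. (g n \<in> T' \<and> length (g n) = n \<and> P (map x [0..<n]) (g n)) \<and>
      (\<exists>m. g (Suc n) = g n @ [m])"
  proof (rule dependent_nat_choice)
    show "\<exists>t. t \<in> T' \<and> length t = 0 \<and> P (map x [0..<0]) t" using root T'(1) by auto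
    fix t n assume "t \<in> T' \<and> length t = n \<and> P (map x [0..<n]) t"
    thus "\<exists>u. (u \<in> T' \<and> length u = Suc n \<and> P (map x [0..<Suc n]) u) \<and> (\<exists>m. u = t @ [m])"
      using step[of "map x [0..<n]" t "x n"] x[of "Suc n"] by auto
  qed
  then obtain g where g: "\<And>n. g n \<in> T'" "g 0 = []" "\<And>n. \<exists>m. g (Suc n) = g n @ [m]"
    by (metis length_0_conv)
  from g(3) obtain y where y: "\<And>n. g (Suc n) = g n @ [y n]" by metis
  have "g n = map y [0..<n]" for n by (induction n) (auto simp: g(2) y)
  with g(1) T'(2) show False by (metis wf_tree_def)
qed

text \<open>
  Ranks refer to arbitrary proper extensions. Matching children with children extends to these by
  induction on the number of added terms, and then each successor of a rank entering the supremum at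
  \<open>s\<close> is bounded by one entering the supremum at \<open>t\<close>.
\<close>

lemma tree_rank_simulation:
  assumes trees: "is_tree T" "is_tree T'" and root: "P [] []" "[] \<in> T'"
    and step: "\<And>s t n. P s t \<Longrightarrow> s @ [n] \<in> T \<Longrightarrow> \<exists>m. t @ [m] \<in> T' \<and> P (s @ [n]) (t @ [m])"
  shows "tree_rank T \<le> tree_rank T'"
proof (cases "wf_tree T' \<and> T \<noteq> {}")
  case False
  thus ?thesis
    using tree_rank_le_omega1[OF trees(1)] root(2) zero_le_ordinal by (auto simp: tree_rank_def)
next
  case True
  hence wf': "wf_tree T'" and "T \<noteq> {}" by auto
  have wf: "wf_tree T" using wf_tree_simulation[of P, OF root(1) step root(2) wf'] .
  have extend: "\<exists>t'\<in>T'. strict_prefix t t' \<and> P (s @ u) t'"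
    if "P s t" "s @ u \<in> T" "u \<noteq> []" for s t u
    using that
  proof (induction u arbitrary: s t)
    case (Cons n u)
    have "s @ [n] \<in> T"
      using trees(1) Cons.prems(2) unfolding is_tree_def by (metis append_Cons append_Nil append_assoc prefixI)
    then obtain m where m: "t @ [m] \<in> T'" "P (s @ [n]) (t @ [m])"
      using step Cons.prems(1) by blast
    show ?case
    proof (cases "u = []")
      case True
      have "strict_prefix t (t @ [m])" by (simp add: strict_prefix_def)
      with m True show ?thesis by blast
    next
      case False
      with Cons.IH[OF m(2)] Cons.prems(2) obtain t' where
        "t' \<in> T'" "strict_prefix (t @ [m]) t'" "P (s @ n # u) t'" by auto
      thus ?thesis
        by (meson prefixI prefix_order.le_less_trans)
    qed
  qed simp
  \<comment> \<open>Induction runs over \<open>t\<close>, so that every \<open>s\<close> simulated by \<open>t\<close> is covered at once.\<close>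
  have "P s t \<Longrightarrow> node_rank T s \<le> node_rank T' t" for s t
    using wf_tree_rel[OF trees(2) wf']
  proof (induction t arbitrary: s rule: wf_induct_rule)
    case (less t)
    show ?case
    proof (subst node_rank_eq[OF trees(1) wf], rule SUP_ordinal_least)
      fix s' assume "s' \<in> {s' \<in> T. strict_prefix s s'}"
      then obtain u where u: "s' = s @ u" "s' \<in> T" "u \<noteq> []"
        by (auto elim: strict_prefixE')
      then obtain t' where t': "t' \<in> T'" "strict_prefix t t'" "P s' t'"
        using extend less.prems by blast
      have "node_rank T s' \<le> node_rank T' t'" using less.IH t' by blast
      also have "\<dots> < node_rank T' t"
        by (rule node_rank_extension_less[OF trees(2) wf' t'(1,2)])
      finally show "osucc (node_rank T s') \<le> node_rank T' t"
        by (simp add: osucc_le_iff node_rank_less_omega1[OF trees(1) wf])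
    qed
  qed
  hence "node_rank T [] \<le> node_rank T' []" using root(1) .
  hence "osucc (node_rank T []) \<le> osucc (node_rank T' [])"
    using osucc_countable(1)[OF node_rank_less_omega1[OF trees(2) wf']]
    by (simp add: osucc_le_iff node_rank_less_omega1[OF trees(1) wf] le_less_trans)
  thus ?thesis using wf wf' \<open>T \<noteq> {}\<close> root(2) by (auto simp: tree_rank_def)
qed


section \<open>Subgroups as marked groups\<close>

lemma group_grp: "N \<in> marked_groups \<Longrightarrow> group (grp N)"
  by (simp add: marked_groups_def normal.factorgroup_is_group)

lemma proj_hom: "N \<in> marked_groups \<Longrightarrow> group_hom \<F> (grp N) (proj N)"
  using normal.r_coset_hom_Mod[of N \<F>] group_grp[of N]
  by (simp add: marked_groups_def proj_def[abs_def] group_hom_def group_hom_axioms_def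
      group_free_group)

lemma carrier_grp: "carrier (grp N) = proj N ` carrier \<F>"
  by (simp add: carrier_FactGroup proj_def[abs_def])

text \<open>
  Evaluating a word only multiplies generators and their inverses, and the letters hit all
  generators.
\<close>

lemma free_hom_image:
  assumes "group G" and f: "\<And>i. f i \<in> carrier G"
  shows "free_hom G f ` carrier \<F> = generate G (range f)"
proof
  interpret group_hom \<F> G "free_hom G f"
    using free_hom_hom(1)[OF assms] assms(1)
    by (simp add: group_hom_def group_hom_axioms_def group_free_group)
  have "free_hom G f w \<in> generate G (range f)" for w
  proof (induction w)
    case Nil
    show ?case by (simp add: free_hom_def generate.one)
  next
    case (Cons x w)
    have "(if fst x then inv\<^bsub>G\<^esub> f (snd x) else f (snd x)) \<in> generate G (range f)"
      by (simp add: generate.incl generate.inv)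
    from generate.eng[OF this Cons] show ?case
      by (simp add: free_hom_def case_prod_beta)
  qed
  thus "free_hom G f ` carrier \<F> \<subseteq> generate G (range f)" by blast
  have "letter i \<in> carrier \<F>" for i by (simp add: letter_def free_group_def)
  hence "free_hom G f (letter i) \<in> free_hom G f ` carrier \<F>" for i by (rule imageI)
  hence "range f \<subseteq> free_hom G f ` carrier \<F>"
    by (simp add: free_hom_hom(2)[OF assms] image_subset_iff)
  thus "generate G (range f) \<subseteq> free_hom G f ` carrier \<F>"
    by (rule H.generate_subgroup_incl[OF _ img_is_subgroup])
qed

text \<open>
  First isomorphism theorem for the map \<open>\<F> \<rightarrow> \<F> / N\<close> whose kernel defines the marking: its
  image is generated by the images of the letters.
\<close>

lemma mark_via_iso:
  assumes N: "N \<in> marked_groups" and p: "\<And>j. p j \<in> carrier \<F>"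
  shows "grp (mark_via N p) \<cong>
    (grp N)\<lparr>carrier := generate (grp N) (range (proj N \<circ> p))\<rparr>"
proof -
  let ?h = "proj N \<circ> free_hom \<F> p" and ?K = "generate (grp N) (range (proj N \<circ> p))"
  interpret q: group_hom \<F> "grp N" "proj N" by (rule proj_hom[OF N])
  have image: "?h ` carrier \<F> = ?K"
    using q.generate_img[of "range p"] p free_hom_image[OF group_free_group, of p]
    by (simp only: image_comp[symmetric] image_subset_iff) simp
  have "subgroup ?K (grp N)"
    using p by (intro q.H.generate_is_subgroup) auto
  moreover have hom: "?h \<in> hom \<F> (grp N)"
    using Group.hom_compose[OF free_hom_hom(1)[OF group_free_group p] q.homh] .
  ultimately have "group_hom \<F> ((grp N)\<lparr>carrier := ?K\<rparr>) ?h"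
    using image q.H.subgroup_imp_group[of ?K]
    by (auto simp: group_hom_def group_hom_axioms_def group_free_group hom_def)
  from group_hom.FactGroup_iso[OF this] image show ?thesis
    by (simp add: mark_via_def kernel_def)
qed

lemma mon_compose:
  assumes "f \<in> mon A B" "g \<in> mon B C"
  shows "g \<circ> f \<in> mon A C"
proof -
  have "f ` carrier A \<subseteq> carrier B" using assms(1) by (simp add: mon_def hom_carrier)
  with assms show ?thesis
    unfolding mon_def by (blast intro: Group.hom_compose comp_inj_on inj_on_subset)
qed

lemma iso_imp_mon: "f \<in> iso A B \<Longrightarrow> f \<in> mon A B"
  by (auto simp: iso_def mon_def bij_betw_def)

lemma mon_restrict:
  assumes "f \<in> mon A B" "K \<subseteq> carrier A" "f ` K \<subseteq> L"
  shows "f \<in> mon (A\<lparr>carrier := K\<rparr>) (B\<lparr>carrier := L\<rparr>)"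
  using assms by (auto simp: mon_def hom_def subset_iff intro: inj_on_subset)

text \<open>
  It suffices to control an embedding on generators. Both operations \<open>R\<close> and \<open>S\<close> are instances of
  the construction \<open>mark_via\<close>, and both will be handled by this criterion.
\<close>

lemma mark_via_mon:
  assumes N: "N \<in> marked_groups" and N': "N' \<in> marked_groups"
    and p: "\<And>j. p j \<in> carrier \<F>" and p': "\<And>j. p' j \<in> carrier \<F>"
    and \<phi>: "\<phi> \<in> mon (grp N) (grp N')"
    and gens: "\<And>j. \<phi> (proj N (p j)) \<in> generate (grp N') (range (proj N' \<circ> p'))"
  shows "\<exists>\<psi>. \<psi> \<in> mon (grp (mark_via N p)) (grp (mark_via N' p'))"
proof -
  let ?X = "range (proj N \<circ> p)" and ?X' = "range (proj N' \<circ> p')"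
  let ?K = "generate (grp N) ?X" and ?K' = "generate (grp N') ?X'"
  interpret q: group_hom \<F> "grp N" "proj N" by (rule proj_hom[OF N])
  interpret q': group_hom \<F> "grp N'" "proj N'" by (rule proj_hom[OF N'])
  interpret \<phi>: group_hom "grp N" "grp N'" \<phi>
    using \<phi> by unfold_locales (simp add: mon_def)
  have X: "?X \<subseteq> carrier (grp N)" and X': "?X' \<subseteq> carrier (grp N')" using p p' by auto
  have "\<phi> ` ?K = generate (grp N') (\<phi> ` ?X)" using \<phi>.generate_img[OF X] by simp
  also have "\<dots> \<subseteq> ?K'"
    using gens by (intro q'.H.generate_subgroup_incl q'.H.generate_is_subgroup X') auto
  finally have mid: "\<phi> \<in> mon ((grp N)\<lparr>carrier := ?K\<rparr>) ((grp N')\<lparr>carrier := ?K'\<rparr>)"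
    by (intro mon_restrict \<phi> q.H.generate_incl X)
  obtain \<alpha> where "\<alpha> \<in> iso (grp (mark_via N p)) ((grp N)\<lparr>carrier := ?K\<rparr>)"
    using mark_via_iso[where p = p, OF N p] unfolding is_iso_def by blast
  moreover have "group (grp (mark_via N' p'))"
    by (rule group_grp[OF mark_via_in_marked_groups[where p = p', OF N' p']])
  from group.iso_sym[OF this mark_via_iso[where p = p', OF N' p']]
  obtain \<beta> where "\<beta> \<in> iso ((grp N')\<lparr>carrier := ?K'\<rparr>) (grp (mark_via N' p'))"
    unfolding is_iso_def by blast
  ultimately have "\<beta> \<circ> (\<phi> \<circ> \<alpha>) \<in> mon (grp (mark_via N p)) (grp (mark_via N' p'))"
    by (rule mon_compose[OF mon_compose[OF iso_imp_mon mid] iso_imp_mon])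
  thus ?thesis by blast
qed


section \<open>The decomposition step respects embeddings\<close>

text \<open>
  For \<open>M\<close> normal in \<open>B\<close>, the preimage of \<open>M\<close> is the kernel of \<open>A \<rightarrow> B / M\<close>, and its cosets inject
  into those of \<open>M\<close>. So its index is finite and at most \<open>k + 1 \<le> l + 1\<close>, and it is among the
  subgroups intersected in \<open>S\<^sub>l(A)\<close>.
\<close>

lemma S_subgroup_mon_image:
  assumes "group A" "group B" and \<phi>: "\<phi> \<in> mon A B" and "k \<le> l"
  shows "\<phi> ` S_subgroup l A \<subseteq> S_subgroup k B"
proof -
  interpret \<phi>: group_hom A B \<phi>
    using assms by (simp add: group_hom_def group_hom_axioms_def mon_def)
  have derived: "\<phi> ` derived A (carrier A) \<subseteq> derived B (carrier B)"
    using \<phi>.derived_img[of "carrier A"] \<phi>.H.mono_derived[of "\<phi> ` carrier A" "carrier B"]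
      \<phi>.hom_closed by blast
  have "\<phi> x \<in> M"
    if x: "x \<in> S_subgroup l A" and M: "M \<lhd> B" "finite (rcosets\<^bsub>B\<^esub> M)" "card (rcosets\<^bsub>B\<^esub> M) \<le> k + 1"
    for x M
  proof -
    interpret M: normal M B by fact
    let ?q = "\<lambda>a. M #>\<^bsub>B\<^esub> \<phi> a"
    let ?P = "kernel A (B Mod M) ?q"
    interpret q: group_hom A "B Mod M" ?q
      using Group.hom_compose[OF \<phi>.homh M.r_coset_hom_Mod] M.factorgroup_is_group assms(1)
      by (simp add: group_hom_def group_hom_axioms_def comp_def)
    have inj: "inj_on (\<lambda>X. the_elem (?q ` X)) (rcosets\<^bsub>A\<^esub> ?P)"
      "(\<lambda>X. the_elem (?q ` X)) ` (rcosets\<^bsub>A\<^esub> ?P) \<subseteq> rcosets\<^bsub>B\<^esub> M"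
      using q.FactGroup_inj_on q.FactGroup_the_elem_mem by (auto simp: FactGroup_def)
    have "finite (rcosets\<^bsub>A\<^esub> ?P)"
      using inj M(2) by (rule inj_on_finite)
    moreover have "card (rcosets\<^bsub>A\<^esub> ?P) \<le> l + 1"
      using card_inj_on_le[OF inj M(2)] M(3) \<open>k \<le> l\<close> by simp
    ultimately have "x \<in> ?P"
      using x q.normal_kernel by (auto simp: S_subgroup_def)
    thus "\<phi> x \<in> M"
      using \<phi>.H.rcos_self[OF _ M.subgroup_axioms, of "\<phi> x"] by (auto simp: kernel_def)
  qed
  with derived show ?thesis by (auto simp: S_subgroup_def)
qed

lemma trivial_if_mon_trivial:
  assumes "group A" "group B" "\<phi> \<in> mon A B" "carrier B = {\<one>\<^bsub>B\<^esub>}"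
  shows "carrier A = {\<one>\<^bsub>A\<^esub>}"
proof -
  interpret \<phi>: group_hom A B \<phi>
    using assms by (simp add: group_hom_def group_hom_axioms_def mon_def)
  have "x = \<one>\<^bsub>A\<^esub>" if "x \<in> carrier A" for x
    using mon_iff_hom_one[OF assms(1,2)] assms(3,4) \<phi>.hom_closed[OF that] that by blast
  thus ?thesis by blast
qed

context
  fixes \<gamma> :: "nat \<Rightarrow> word"
  assumes enum: "range \<gamma> = carrier \<F>"
begin

lemma enum_closed: "\<gamma> j \<in> carrier \<F>"
  using enum by blast

lemma one_free_group_closed: "\<one>\<^bsub>\<F>\<^esub> \<in> carrier \<F>"
  by (simp add: free_group_def)

lemma carrier_grp_enum: "carrier (grp N) = range (\<lambda>j. proj N (\<gamma> j))"
  by (simp add: carrier_grp flip: enum) (simp add: image_comp comp_def)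

lemma R_marked_in_marked_groups: "M \<in> marked_groups \<Longrightarrow> R_marked \<gamma> n M \<in> marked_groups"
  unfolding R_marked_def mark_generated_def
  by (rule mark_via_in_marked_groups) (auto simp: enum_closed one_free_group_closed)

lemma S_marked_in_marked_groups: "M \<in> marked_groups \<Longrightarrow> S_marked \<gamma> k M \<in> marked_groups"
  unfolding S_marked_def mark_subgroup_def
  by (rule mark_via_in_marked_groups) (auto simp: enum_closed one_free_group_closed)

text \<open>
  The images of the first \<open>n + 1\<close> listed elements may be listed late in the second group, so \<open>m\<close>
  is the largest of the positions where they are found.
\<close>

lemma R_marked_mon:
  assumes M: "M \<in> marked_groups" and M': "M' \<in> marked_groups" and \<phi>: "\<phi> \<in> mon (grp M) (grp M')"
  shows "\<exists>m \<psi>. \<psi> \<in> mon (grp (R_marked \<gamma> n M)) (grp (R_marked \<gamma> m M'))"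
proof -
  interpret q: group_hom \<F> "grp M" "proj M" by (rule proj_hom[OF M])
  interpret q': group_hom \<F> "grp M'" "proj M'" by (rule proj_hom[OF M'])
  interpret \<phi>: group_hom "grp M" "grp M'" \<phi>
    using \<phi> by unfold_locales (simp add: mon_def)
  have "\<exists>j. \<phi> (proj M (\<gamma> i)) = proj M' (\<gamma> j)" for i
    using \<phi>.hom_closed[of "proj M (\<gamma> i)"] carrier_grp_enum[of M] carrier_grp_enum[of M'] by auto
  then obtain j where j: "\<And>i. \<phi> (proj M (\<gamma> i)) = proj M' (\<gamma> (j i))" by metis
  define m where "m = Max (j ` {0..n})"
  have m: "j i \<le> m" if "i \<le> n" for i using that by (auto simp: m_def)
  let ?p = "\<lambda>n i. if i \<in> {0..n} then \<gamma> i else \<one>\<^bsub>\<F>\<^esub>"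
  have gens: "\<phi> (proj M (?p n i)) \<in> generate (grp M') (range (proj M' \<circ> ?p m))" for i
  proof (cases "i \<le> n")
    case True
    hence "\<phi> (proj M (?p n i)) = (proj M' \<circ> ?p m) (j i)" using j m by simp
    thus ?thesis by (simp only: generate.incl[OF rangeI])
  next
    case False
    thus ?thesis using generate.one[of "grp M'"] by (simp del: one_FactGroup)
  qed
  have "\<exists>\<psi>. \<psi> \<in> mon (grp (mark_via M (?p n))) (grp (mark_via M' (?p m)))"
    by (rule mark_via_mon[where p = "?p n" and p' = "?p m", OF M M' _ _ \<phi> gens])
      (simp_all add: enum_closed one_free_group_closed)
  thus ?thesis unfolding R_marked_def mark_generated_def by blast
qed

text \<open>
  The marking of \<open>S\<^sub>l\<close> lists every element of this subgroup, because the enumeration exhausts the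
  ambient group; so it is enough that the embedding maps \<open>S\<^sub>l\<close> into \<open>S\<^sub>k\<close>.
\<close>

lemma S_marked_mon:
  assumes M: "M \<in> marked_groups" and M': "M' \<in> marked_groups" and \<phi>: "\<phi> \<in> mon (grp M) (grp M')"
    and "k \<le> l"
  shows "\<exists>\<psi>. \<psi> \<in> mon (grp (S_marked \<gamma> l M)) (grp (S_marked \<gamma> k M'))"
proof -
  interpret q: group_hom \<F> "grp M" "proj M" by (rule proj_hom[OF M])
  interpret q': group_hom \<F> "grp M'" "proj M'" by (rule proj_hom[OF M'])
  interpret \<phi>: group_hom "grp M" "grp M'" \<phi>
    using \<phi> by unfold_locales (simp add: mon_def)
  let ?p = "\<lambda>M l j. if proj M (\<gamma> j) \<in> S_subgroup l (grp M) then \<gamma> j else \<one>\<^bsub>\<F>\<^esub>"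
  have gens: "\<phi> (proj M (?p M l j)) \<in> generate (grp M') (range (proj M' \<circ> ?p M' k))" for j
  proof (cases "proj M (\<gamma> j) \<in> S_subgroup l (grp M)")
    case True
    hence "\<phi> (proj M (\<gamma> j)) \<in> S_subgroup k (grp M')"
      using S_subgroup_mon_image[OF q.H.is_group q'.H.is_group \<phi> \<open>k \<le> l\<close>] by blast
    moreover obtain i where i: "\<phi> (proj M (\<gamma> j)) = proj M' (\<gamma> i)"
      using \<phi>.hom_closed[of "proj M (\<gamma> j)"] carrier_grp_enum[of M] carrier_grp_enum[of M'] by auto
    ultimately have "\<phi> (proj M (?p M l j)) = (proj M' \<circ> ?p M' k) i" using True by simp
    thus ?thesis by (simp only: generate.incl[OF rangeI])
  next
    case False
    thus ?thesis using generate.one[of "grp M'"] by (simp del: one_FactGroup)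
  qed
  show ?thesis
    unfolding S_marked_def mark_subgroup_def
    by (rule mark_via_mon[where p = "?p M l" and p' = "?p M' k", OF M M' _ _ \<phi> gens])
      (simp_all add: enum_closed one_free_group_closed)
qed

lemma decomp_in_marked_groups: "decomp \<gamma> l N s M \<Longrightarrow> N \<in> marked_groups \<Longrightarrow> M \<in> marked_groups"
  by (induction rule: decomp.induct) (auto intro: S_marked_in_marked_groups R_marked_in_marked_groups)

text \<open>
  The simulation relates nodes of equal length because the parameter of \<open>S\<close> at a node is its length
  plus \<open>l\<close> or \<open>k\<close>: equal lengths reduce the comparison of parameters to \<open>k \<le> l\<close>.
\<close>

lemma tree_rank_decomp_tree_mono:
  assumes H: "H \<in> marked_groups" and G: "G \<in> marked_groups"
    and mon: "\<phi> \<in> mon (grp H) (grp G)" and "k \<le> l"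
  shows "tree_rank (decomp_tree \<gamma> l H) \<le> tree_rank (decomp_tree \<gamma> k G)"
proof -
  define P where "P s t \<longleftrightarrow> length s = length t \<and>
    (\<exists>A B \<psi>. decomp \<gamma> l H s A \<and> decomp \<gamma> k G t B \<and> \<psi> \<in> mon (grp A) (grp B))" for s t
  show ?thesis
  proof (rule tree_rank_simulation[of _ _ P])
    show "P [] []" using mon by (auto simp: P_def intro: decomp.root)
    show "[] \<in> decomp_tree \<gamma> k G" by (auto simp: decomp_tree_def intro: decomp.root)
    fix s t n assume "P s t" and ext: "s @ [n] \<in> decomp_tree \<gamma> l H"
    then obtain A B \<psi> where len: "length s = length t" and A: "decomp \<gamma> l H s A"
      and B: "decomp \<gamma> k G t B" and \<psi>: "\<psi> \<in> mon (grp A) (grp B)"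
      by (auto simp: P_def)
    note [simp] = decomp_in_marked_groups[OF A H] decomp_in_marked_groups[OF B G]
    from ext obtain A' where "decomp \<gamma> l H (s @ [n]) A'" by (auto simp: decomp_tree_def)
    hence nontriv: "carrier (grp A) \<noteq> {\<one>\<^bsub>grp A\<^esub>}"
      by cases (auto dest: decomp_unique[OF A])
    hence nontriv': "carrier (grp B) \<noteq> {\<one>\<^bsub>grp B\<^esub>}"
      using trivial_if_mon_trivial[OF group_grp group_grp \<psi>] by auto
    obtain m \<chi> where "\<chi> \<in> mon (grp (R_marked \<gamma> n A)) (grp (R_marked \<gamma> m B))"
      using R_marked_mon[OF _ _ \<psi>, of n] by auto
    then obtain \<omega> where "\<omega> \<in> mon (grp (S_marked \<gamma> (length s + l) (R_marked \<gamma> n A)))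
        (grp (S_marked \<gamma> (length t + k) (R_marked \<gamma> m B)))"
      using S_marked_mon[of "R_marked \<gamma> n A" "R_marked \<gamma> m B" _ "length t + k" "length s + l"]
        len \<open>k \<le> l\<close> by (auto simp: R_marked_in_marked_groups)
    hence "P (s @ [n]) (t @ [m])"
      using len decomp.step[OF A nontriv] decomp.step[OF B nontriv'] unfolding P_def
      by (intro conjI exI) (assumption | simp)+
    moreover have "t @ [m] \<in> decomp_tree \<gamma> k G"
      using decomp.step[OF B nontriv'] unfolding decomp_tree_def by blast
    ultimately show "\<exists>m. t @ [m] \<in> decomp_tree \<gamma> k G \<and> P (s @ [n]) (t @ [m])" by blast
  qed (rule is_tree_decomp_tree)+
qed

end

theorem lemma6p5:
  fixes \<gamma> :: "nat \<Rightarrow> word"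
  assumes "range \<gamma> = carrier \<F>"
  shows "(\<forall>G \<in> marked_groups. \<forall>H \<in> marked_groups. (\<exists>\<phi>. \<phi> \<in> mon (grp H) (grp G)) \<longrightarrow>
            (\<forall>l k. l \<ge> k \<and> k \<ge> 1 \<longrightarrow>
               tree_rank (decomp_tree \<gamma> l H) \<le> tree_rank (decomp_tree \<gamma> k G))) \<and>
         (\<forall>G \<in> marked_groups. \<forall>G' \<in> marked_groups. grp G \<cong> grp G' \<longrightarrow>
            (\<forall>l \<ge> 1. tree_rank (decomp_tree \<gamma> l G) = tree_rank (decomp_tree \<gamma> l G')))"
proof (intro conjI ballI impI allI)
  fix G H and l k :: nat
  assume "G \<in> marked_groups" "H \<in> marked_groups" "\<exists>\<phi>. \<phi> \<in> mon (grp H) (grp G)" "k \<le> l \<and> 1 \<le> k"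
  thus "tree_rank (decomp_tree \<gamma> l H) \<le> tree_rank (decomp_tree \<gamma> k G)"
    using tree_rank_decomp_tree_mono[OF assms] by blast
next
  fix G G' and l :: nat
  assume G: "G \<in> marked_groups" "G' \<in> marked_groups" and iso: "grp G \<cong> grp G'"
  obtain \<phi> where "\<phi> \<in> mon (grp G) (grp G')"
    using iso by (auto simp: is_iso_def intro: iso_imp_mon)
  moreover obtain \<psi> where "\<psi> \<in> mon (grp G') (grp G)"
    using group.iso_sym[OF group_grp[OF G(1)] iso] by (auto simp: is_iso_def intro: iso_imp_mon)
  ultimately show "tree_rank (decomp_tree \<gamma> l G) = tree_rank (decomp_tree \<gamma> l G')"
    using tree_rank_decomp_tree_mono[OF assms] G by (blast intro: antisym)
qed

end
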